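(* Let $n\geq 4$ be an even integer, let $k\geq 3$ be an odd integer, and let $G$ be a connected graph of order $n$. (1) If $n \geq 8$ and $\rho(G)\geq \rho(K_1 \vee (K_{n-2}+K_1))$, then $G$ is $\mathrm{GBC}_k$ unless $G = K_1 \vee (K_{n-2}+K_1)$. (2) If $4\leq n \leq 6$ and $\rho(G)\geq \rho(K_{\frac{n}{2}} \vee \frac{n}{2}K_1)$, then $G$ is $\mathrm{GBC}_k$ unless $G = K_{\frac{n}{2}} \vee \frac{n}{2}K_1$.
   Context: All graphs are finite, simple and undirected. The order of $G$ is its number of vertices. $\rho(G)$ is the largest eigenvalue of the adjacency matrix of $G$. $K_m$ is the complete graph on $m$ vertices, $G_1+G_2$ is the (vertex-disjoint) union, $mK_1$ is the graph consisting of $m$ isolated vertices, and the join $G_1\vee G_2$ is obtained from vertex-disjoint $G_1,G_2$ by adding all edges between $V(G_1)$ and $V(G_2)$. Equality of graphs means isomorphism. For a graph $H$, let $\mathrm{odd}(H)$ be the number of nontrivial odd components of $H$ (connected components with an odd number, at least $3$, of vertices) and $i(H)$ the number of isolated vertices of $H$. For odd $k$ define $$\mathrm{def}_k(G)=\max_{S\subseteq V(G)}\{\mathrm{odd}(G-S)+k\cdot i(G-S)-k|S|\}.$$ A $k$-barrier of $G$ is a subset $S\subseteq V(G)$ attaining this maximum. A graph $G$ of even order is generalized bicritical, written $\mathrm{GBC}_k$, if $\emptyset$ is its only $k$-barrier. *)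

theory Defs
  imports "Graph_Theory.Graph_Theory" "Jordan_Normal_Form.Spectral_Radius"
begin

text \<open>
  A finite simple undirected graph is a \<open>pair_graph\<close>: a finite, loop-free, symmetric digraph
  whose arcs are ordered pairs of vertices, an edge $uv$ being the two arcs $(u,v)$ and $(v,u)$.
  The strongly connected components (\<open>sccs\<close>) of such a graph are its connected components.
\<close>

definition complete_graph :: "nat \<Rightarrow> nat pair_pre_digraph" where
  "complete_graph m =
    \<lparr> pverts = {0..<m}, parcs = {(u, v). u \<in> {0..<m} \<and> v \<in> {0..<m} \<and> u \<noteq> v} \<rparr>"

definition edgeless_graph :: "nat \<Rightarrow> nat pair_pre_digraph" where
  "edgeless_graph m = \<lparr> pverts = {0..<m}, parcs = {} \<rparr>"

text \<open>The sum type makes the two operands of a union or a join vertex-disjoint.\<close>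

definition disjoint_union ::
    "'a pair_pre_digraph \<Rightarrow> 'b pair_pre_digraph \<Rightarrow> ('a + 'b) pair_pre_digraph" where
  "disjoint_union G H =
    \<lparr> pverts = Inl ` pverts G \<union> Inr ` pverts H,
      parcs = map_prod Inl Inl ` parcs G \<union> map_prod Inr Inr ` parcs H \<rparr>"

definition graph_join ::
    "'a pair_pre_digraph \<Rightarrow> 'b pair_pre_digraph \<Rightarrow> ('a + 'b) pair_pre_digraph" where
  "graph_join G H =
    \<lparr> pverts = Inl ` pverts G \<union> Inr ` pverts H,
      parcs = map_prod Inl Inl ` parcs G \<union> map_prod Inr Inr ` parcs H
        \<union> (Inl ` pverts G) \<times> (Inr ` pverts H) \<union> (Inr ` pverts H) \<times> (Inl ` pverts G) \<rparr>"

definition adjacency_matrix :: "'a pair_pre_digraph \<Rightarrow> 'a list \<Rightarrow> real mat" where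
  "adjacency_matrix G vs =
    mat (length vs) (length vs) (\<lambda>(i, j). if (vs ! i, vs ! j) \<in> parcs G then 1 else 0)"

text \<open>
  Two enumerations of the vertices give adjacency matrices that differ by a simultaneous permutation
  of rows and columns, so the spectrum does not depend on the enumeration that is chosen. The matrix
  is real and symmetric, so all its eigenvalues are real and \<open>spectrum\<close> over the reals contains
  them all.
\<close>

definition vertex_enumeration :: "'a pair_pre_digraph \<Rightarrow> 'a list" where
  "vertex_enumeration G = (SOME vs. distinct vs \<and> set vs = pverts G)"

definition rho :: "'a pair_pre_digraph \<Rightarrow> real" where
  "rho G = Max (spectrum (adjacency_matrix G (vertex_enumeration G)))"

definition num_odd_components :: "('a, 'b) pre_digraph \<Rightarrow> nat" where
  "num_odd_components H =
    card {C \<in> pre_digraph.sccs H. odd (card (verts C)) \<and> card (verts C) \<ge> 3}"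

definition num_isolated :: "('a, 'b) pre_digraph \<Rightarrow> nat" where
  "num_isolated H = card {v \<in> verts H. in_arcs H v = {} \<and> out_arcs H v = {}}"

definition delete_verts :: "'a pair_pre_digraph \<Rightarrow> 'a set \<Rightarrow> ('a, 'a \<times> 'a) pre_digraph" where
  "delete_verts G S = induce_subgraph (with_proj G) (pverts G - S)"

definition barrier_value :: "nat \<Rightarrow> 'a pair_pre_digraph \<Rightarrow> 'a set \<Rightarrow> int" where
  "barrier_value k G S =
    int (num_odd_components (delete_verts G S)) + int k * int (num_isolated (delete_verts G S))
      - int k * int (card S)"

definition k_deficiency :: "nat \<Rightarrow> 'a pair_pre_digraph \<Rightarrow> int" where
  "k_deficiency k G = Max (barrier_value k G ` Pow (pverts G))"

definition k_barrier :: "nat \<Rightarrow> 'a pair_pre_digraph \<Rightarrow> 'a set \<Rightarrow> bool" where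
  "k_barrier k G S \<longleftrightarrow> S \<subseteq> pverts G \<and> barrier_value k G S = k_deficiency k G"

definition generalized_bicritical :: "nat \<Rightarrow> 'a pair_pre_digraph \<Rightarrow> bool" where
  "generalized_bicritical k G \<longleftrightarrow>
    even (card (pverts G)) \<and> (\<forall>S. k_barrier k G S \<longleftrightarrow> S = {})"

lemma complete_digraph_complete_graph: "complete_digraph m (with_proj (complete_graph m))"
  by (auto simp: complete_digraph_pair_def complete_graph_def)

lemma pair_graph_iff:
  "pair_graph G \<longleftrightarrow> finite (pverts G) \<and> parcs G \<subseteq> pverts G \<times> pverts G \<and>
    sym (parcs G) \<and> irrefl (parcs G)" (is "_ \<longleftrightarrow> ?R")
proof
  assume "pair_graph G"
  then interpret pair_graph G .
  have "irrefl (parcs G)"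
    unfolding irrefl_def using no_loops' by blast
  then show ?R
    using pair_finite_verts pair_sym_arcs in_arcsD1 in_arcsD2
    by (auto simp: symmetric_def)
next
  assume R: ?R
  then have "finite (parcs G)"
    by (meson finite_SigmaI finite_subset)
  with R show "pair_graph G"
    by unfold_locales (auto simp: symmetric_def irrefl_def)
qed

lemma pair_graph_constructions:
  shows "pair_graph (complete_graph m)"
    and "pair_graph (edgeless_graph m)"
    and "pair_graph G \<Longrightarrow> pair_graph H \<Longrightarrow> pair_graph (disjoint_union G H)"
    and "pair_graph G \<Longrightarrow> pair_graph H \<Longrightarrow> pair_graph (graph_join G H)"
  by (auto 0 3 simp: pair_graph_iff complete_graph_def edgeless_graph_def disjoint_union_def
      graph_join_def sym_def irrefl_def map_prod_def image_iff Bex_def)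

end

theory Submission
  imports Defs
begin

text \<open>
  If \<open>G\<close> is not generalized bicritical, some nonempty \<open>S\<close> with $s$ vertices has nonnegative barrier
  value. Either $G - S$ has at least $s$ isolated vertices, and then \<open>G\<close> is a spanning subgraph of
  $K_s \vee (K_{n-2s} + sK_1)$, or it has at least three nontrivial odd components and at least half
  of the vertices of \<open>G\<close>, so that many edges are missing. Apart from the extremal graph itself and
  $n = 8$, $s = 4$, the number $m$ of edges is then so small that Hong's bound
  $\rho^2 \le 2m - n + 1$ puts $\rho(G)$ below the spectral radius of the extremal graph, which is
  bounded from below by an explicit eigenvector. All counts are of arcs, that is, of $2m$.
\<close>

subsection \<open>Adjacency eigenvalues and Hong's bound\<close>

text \<open>Replaces vectors indexed by an enumeration with functions on the vertices, so that the
  enumeration disappears from all later arguments. The field is left general because the complex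
  numbers supply an eigenvalue and \<open>rho\<close> uses the reals.\<close>

lemma eigenvalue_adjacency_iff:
  fixes l :: "'b::field"
  assumes dist: "distinct vs" and sub: "E \<subseteq> set vs \<times> set vs"
  shows "eigenvalue (mat (length vs) (length vs) (\<lambda>(i, j). if (vs ! i, vs ! j) \<in> E then 1 else 0)) l
    \<longleftrightarrow> (\<exists>f. (\<exists>x\<in>set vs. f x \<noteq> 0) \<and> (\<forall>x\<in>set vs. l * f x = (\<Sum>y\<in>E `` {x}. f y)))"
    (is "eigenvalue ?A l \<longleftrightarrow> ?R")
proof -
  have mult: "(?A *\<^sub>v vec (length vs) (\<lambda>j. f (vs ! j))) $ i = (\<Sum>y\<in>E `` {vs ! i}. f y)"
    if i: "i < length vs" for i and f :: "'a \<Rightarrow> 'b"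
  proof -
    have "(?A *\<^sub>v vec (length vs) (\<lambda>j. f (vs ! j))) $ i =
        (\<Sum>j<length vs. if (vs ! i, vs ! j) \<in> E then f (vs ! j) else 0)"
      using i by (auto simp: scalar_prod_def lessThan_atLeast0 intro!: sum.cong)
    also have "\<dots> = (\<Sum>y\<in>set vs. if (vs ! i, y) \<in> E then f y else 0)"
      by (rule sum.reindex_bij_betw[OF bij_betw_nth[OF dist refl refl]])
    also have "\<dots> = (\<Sum>y\<in>E `` {vs ! i}. f y)"
      using sub by (intro sum.mono_neutral_cong_right) auto
    finally show ?thesis .
  qed
  have ev: "eigenvector ?A (vec (length vs) (\<lambda>j. f (vs ! j))) l \<longleftrightarrow>
      (\<exists>x\<in>set vs. f x \<noteq> 0) \<and> (\<forall>x\<in>set vs. l * f x = (\<Sum>y\<in>E `` {x}. f y))"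
    for f :: "'a \<Rightarrow> 'b"
  proof -
    have "vec (length vs) (\<lambda>j. f (vs ! j)) \<noteq> 0\<^sub>v (length vs) \<longleftrightarrow> (\<exists>x\<in>set vs. f x \<noteq> 0)"
      by (auto simp: vec_eq_iff set_conv_nth)
    moreover have "?A *\<^sub>v vec (length vs) (\<lambda>j. f (vs ! j)) = l \<cdot>\<^sub>v vec (length vs) (\<lambda>j. f (vs ! j))
        \<longleftrightarrow> (\<forall>i<length vs. (\<Sum>y\<in>E `` {vs ! i}. f y) = l * f (vs ! i))"
      using mult[where f=f] by (subst vec_eq_iff) (simp del: index_mult_mat_vec)
    moreover have "\<dots> \<longleftrightarrow> (\<forall>x\<in>set vs. l * f x = (\<Sum>y\<in>E `` {x}. f y))"
      by (auto simp: all_set_conv_all_nth)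
    ultimately show ?thesis
      by (simp add: eigenvector_def)
  qed
  show ?thesis
  proof
    assume "eigenvalue ?A l"
    then obtain v where v: "eigenvector ?A v l"
      unfolding eigenvalue_def by blast
    then have dim: "dim_vec v = length vs"
      by (auto simp: eigenvector_def)
    \<comment> \<open>The function carried by \<open>v\<close>: look up the index of
      \<open>x\<close> in \<open>vs\<close> and take that entry.\<close>
    define f where "f x = v $ (inv_into {..<length vs} ((!) vs) x)" for x
    have "f (vs ! i) = v $ i" if "i < length vs" for i
      using that bij_betw_nth[OF dist refl refl] by (simp add: f_def bij_betw_inv_into_left)
    then have "v = vec (length vs) (\<lambda>j. f (vs ! j))"
      using dim by (auto simp: vec_eq_iff)
    from this v have "eigenvector ?A (vec (length vs) (\<lambda>j. f (vs ! j))) l" by (rule subst)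
    then show ?R unfolding ev by (rule exI[of _ f])
  next
    assume ?R
    then show "eigenvalue ?A l" unfolding eigenvalue_def ev[symmetric] by blast
  qed
qed

lemma vertex_enumeration:
  assumes "finite (pverts G)"
  shows "distinct (vertex_enumeration G)" "set (vertex_enumeration G) = pverts G"
proof -
  have "\<exists>vs. distinct vs \<and> set vs = pverts G"
    using finite_distinct_list[OF assms] by blast
  then have "distinct (vertex_enumeration G) \<and> set (vertex_enumeration G) = pverts G"
    unfolding vertex_enumeration_def by (rule someI_ex)
  then show "distinct (vertex_enumeration G)" "set (vertex_enumeration G) = pverts G" by auto
qed

definition adj_eigenfunction :: "'a pair_pre_digraph \<Rightarrow> 'b::field \<Rightarrow> ('a \<Rightarrow> 'b) \<Rightarrow> bool" where
  "adj_eigenfunction G l f \<longleftrightarrow>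
    (\<exists>x\<in>pverts G. f x \<noteq> 0) \<and> (\<forall>x\<in>pverts G. l * f x = (\<Sum>y\<in>parcs G `` {x}. f y))"

lemma spectrum_adjacency_matrix:
  assumes "pair_graph G"
  shows "l \<in> spectrum (adjacency_matrix G (vertex_enumeration G))
    \<longleftrightarrow> (\<exists>f. adj_eigenfunction G l f)"
proof -
  from assms have "finite (pverts G)" "parcs G \<subseteq> pverts G \<times> pverts G"
    by (auto simp: pair_graph_iff)
  with vertex_enumeration[of G] show ?thesis
    using eigenvalue_adjacency_iff[of "vertex_enumeration G" "parcs G" l]
    by (simp add: adjacency_matrix_def spectrum_def adj_eigenfunction_def)
qed

lemma finite_spectrum_adjacency_matrix: "finite (spectrum (adjacency_matrix G vs))"
  by (rule card_finite_spectrum(1)[of _ "length vs"]) (simp add: adjacency_matrix_def)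

text \<open>The Hermitian argument: the quadratic form \<open>q\<close> of the symmetric matrix at
  \<open>f\<close> is real, and it equals \<open>l\<close> times the positive squared norm of
  \<open>f\<close>.\<close>

lemma adjacency_eigenvalue_real:
  fixes f :: "'a \<Rightarrow> complex"
  assumes "pair_graph G" and f: "adj_eigenfunction G l f"
  shows "Im l = 0"
proof -
  let ?V = "pverts G" and ?E = "parcs G"
  have G: "finite ?V" "?E \<subseteq> ?V \<times> ?V" "sym ?E"
    using assms(1) by (auto simp: pair_graph_iff)
  then have finE: "finite ?E" by (meson finite_SigmaI finite_subset)
  define N where "N = (\<Sum>x\<in>?V. (cmod (f x))\<^sup>2)"
  define q where "q = (\<Sum>(x, y)\<in>?E. cnj (f x) * f y)"
  have "l * of_real N = (\<Sum>x\<in>?V. cnj (f x) * (l * f x))"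
    by (simp only: N_def of_real_sum complex_norm_square sum_distrib_left mult_ac)
  also have "\<dots> = (\<Sum>x\<in>?V. \<Sum>y\<in>?E `` {x}. cnj (f x) * f y)"
    using f by (simp add: adj_eigenfunction_def sum_distrib_left)
  also have "\<dots> = (\<Sum>(x, y)\<in>Sigma ?V (\<lambda>x. ?E `` {x}). cnj (f x) * f y)"
    using G finE by (intro sum.Sigma) (auto simp: finite_Image)
  also have "Sigma ?V (\<lambda>x. ?E `` {x}) = ?E"
    using G(2) by auto
  finally have lN: "l * of_real N = q" by (simp add: q_def)
  have "cnj q = (\<Sum>(x, y)\<in>?E. cnj (f y) * f x)"
    unfolding q_def by (simp add: case_prod_unfold mult.commute)
  \<comment> \<open>Reversing every arc permutes \<open>parcs G\<close>, so conjugation only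
    reorders the sum.\<close>
  also have "\<dots> = q"
    unfolding q_def using \<open>sym ?E\<close>
    by (intro sum.reindex_bij_witness[where i=prod.swap and j=prod.swap])
       (auto dest: symD)
  finally have "cnj q = q" .
  then have "Im q = 0"
    by (simp add: complex_eq_iff)
  then have "Im l * N = 0"
    by (simp flip: lN)
  moreover have "N > 0"
    unfolding N_def using f G(1) by (auto simp: adj_eigenfunction_def intro!: sum_pos2)
  ultimately show ?thesis by simp
qed

text \<open>Makes the \<open>Max\<close> in \<open>rho\<close> meaningful. A complex eigenvalue
  exists by algebraic closedness and is real; the real and imaginary parts of its eigenfunction
  satisfy the same equations, and one of them is nonzero.\<close>

lemma adjacency_real_eigenfunction_exists:
  assumes "pair_graph G" "pverts G \<noteq> {}"
  shows "\<exists>(l::real) f. adj_eigenfunction G l f"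
proof -
  let ?vs = "vertex_enumeration G"
  let ?A = "mat (length ?vs) (length ?vs)
    (\<lambda>(i, j). if (?vs ! i, ?vs ! j) \<in> parcs G then 1 else 0) :: complex mat"
  have G: "finite (pverts G)" "parcs G \<subseteq> pverts G \<times> pverts G"
    using assms(1) by (auto simp: pair_graph_iff)
  have "length ?vs \<noteq> 0"
    using vertex_enumeration(2)[OF G(1)] assms(2) by auto
  then have "spectrum ?A \<noteq> {}"
    by (intro spectrum_non_empty[of _ "length ?vs"]) auto
  then obtain l where "eigenvalue ?A l"
    by (auto simp: spectrum_def)
  then obtain f where f: "adj_eigenfunction G l f"
    using eigenvalue_adjacency_iff[of ?vs "parcs G" l] vertex_enumeration[OF G(1)] G(2)
    by (auto simp: adj_eigenfunction_def)
  have l: "l = of_real (Re l)"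
    using adjacency_eigenvalue_real[OF assms(1) f] by (simp add: complex_eq_iff)
  have eq: "of_real (Re l) * f x = (\<Sum>y\<in>parcs G `` {x}. f y)" if "x \<in> pverts G" for x
    using f that by (simp add: adj_eigenfunction_def flip: l)
  have "Re l * Re (f x) = (\<Sum>y\<in>parcs G `` {x}. Re (f y))"
    "Re l * Im (f x) = (\<Sum>y\<in>parcs G `` {x}. Im (f y))" if "x \<in> pverts G" for x
    using arg_cong[OF eq[OF that], of Re] arg_cong[OF eq[OF that], of Im] by auto
  moreover obtain x where "x \<in> pverts G" "Re (f x) \<noteq> 0 \<or> Im (f x) \<noteq> 0"
    using f by (auto simp: adj_eigenfunction_def complex_eq_iff)
  ultimately have "adj_eigenfunction G (Re l) (\<lambda>x. Re (f x)) \<or>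
      adj_eigenfunction G (Re l) (\<lambda>x. Im (f x))"
    by (auto simp: adj_eigenfunction_def)
  then show ?thesis by blast
qed

lemma rho_eigenfunction:
  assumes "pair_graph G" "pverts G \<noteq> {}"
  shows "\<exists>f. adj_eigenfunction G (rho G) f"
proof -
  obtain l :: real and f where "adj_eigenfunction G l f"
    using adjacency_real_eigenfunction_exists[OF assms] by blast
  then have "l \<in> spectrum (adjacency_matrix G (vertex_enumeration G))"
    unfolding spectrum_adjacency_matrix[OF assms(1)] by blast
  then have "rho G \<in> spectrum (adjacency_matrix G (vertex_enumeration G))"
    unfolding rho_def using finite_spectrum_adjacency_matrix Max_in by blast
  then show ?thesis
    unfolding spectrum_adjacency_matrix[OF assms(1)] .
qed

lemma eigenvalue_le_rho:
  assumes "pair_graph G" "adj_eigenfunction G l f"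
  shows "l \<le> rho G"
proof -
  have "l \<in> spectrum (adjacency_matrix G (vertex_enumeration G))"
    unfolding spectrum_adjacency_matrix[OF assms(1)] using assms(2) by blast
  then show ?thesis
    unfolding rho_def by (rule Max_ge[OF finite_spectrum_adjacency_matrix])
qed

section \<open>Upper bounds for the spectral radius\<close>

text \<open>A Collatz-Wielandt bound: compare both sides of the eigenvalue equation at a vertex
  where \<open>\<bar>f x\<bar> / w x\<close> is largest.\<close>

lemma rho_le_weighted:
  assumes G: "pair_graph G" "pverts G \<noteq> {}"
    and pos: "\<And>x. x \<in> pverts G \<Longrightarrow> 0 < w x"
    and le: "\<And>x. x \<in> pverts G \<Longrightarrow> (\<Sum>y\<in>parcs G `` {x}. w y) \<le> c * w x"
  shows "rho G \<le> c"
proof -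
  let ?V = "pverts G" and ?E = "parcs G"
  have fin: "finite ?V" and sub: "?E \<subseteq> ?V \<times> ?V"
    using G by (auto simp: pair_graph_iff)
  obtain f where f: "\<exists>x\<in>?V. f x \<noteq> 0" "\<And>x. x \<in> ?V \<Longrightarrow> rho G * f x = (\<Sum>y\<in>?E `` {x}. f y)"
    using rho_eigenfunction[OF G] by (auto simp: adj_eigenfunction_def)
  define m where "m = Max ((\<lambda>x. \<bar>f x\<bar> / w x) ` ?V)"
  have "m \<in> (\<lambda>x. \<bar>f x\<bar> / w x) ` ?V"
    unfolding m_def using fin G(2) by (intro Max_in) auto
  then obtain x where x: "x \<in> ?V" "\<bar>f x\<bar> / w x = m" by auto
  have "\<bar>f y\<bar> / w y \<le> m" if "y \<in> ?V" for y
    unfolding m_def using fin that by auto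
  then have bound: "\<bar>f y\<bar> \<le> m * w y" if "y \<in> ?V" for y
    using pos that by (simp add: pos_divide_le_eq)
  have fx: "\<bar>f x\<bar> = m * w x"
    using x pos[OF x(1)] by auto
  obtain z where "z \<in> ?V" "f z \<noteq> 0" using f(1) by auto
  then have "0 < m"
    using bound[of z] pos[of z] by (smt (verit) mult_nonneg_nonpos2 zero_less_abs_iff)
  have "rho G * \<bar>f x\<bar> \<le> \<bar>rho G * f x\<bar>"
    by (metis abs_ge_self abs_ge_zero abs_mult mult_right_mono)
  also have "\<dots> \<le> (\<Sum>y\<in>?E `` {x}. \<bar>f y\<bar>)"
    using f(2)[OF x(1)] by simp
  also have "\<dots> \<le> (\<Sum>y\<in>?E `` {x}. m * w y)"
    using bound sub by (intro sum_mono) auto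
  also have "\<dots> \<le> m * (c * w x)"
    using le[OF x(1)] \<open>0 < m\<close> by (simp flip: sum_distrib_left)
  finally have "rho G * (m * w x) \<le> c * (m * w x)"
    by (simp add: fx mult_ac)
  then show ?thesis
    using \<open>0 < m\<close> pos[OF x(1)] by (simp add: mult_le_cancel_right)
qed

text \<open>The degree sum over the neighbours of \<open>x\<close> counts the walks of length two
  from \<open>x\<close>, that is, a row sum of the squared adjacency matrix. Applying the eigenvalue
  equation twice at a vertex where \<open>\<bar>f x\<bar>\<close> is largest gives the
  bound.\<close>

lemma rho_squared_le:
  assumes G: "pair_graph G" "pverts G \<noteq> {}"
    and le: "\<And>x. x \<in> pverts G \<Longrightarrow> (\<Sum>y\<in>parcs G `` {x}. card (parcs G `` {y})) \<le> c"
  shows "(rho G)\<^sup>2 \<le> real c"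
proof -
  let ?V = "pverts G" and ?E = "parcs G"
  have fin: "finite ?V" and sub: "?E \<subseteq> ?V \<times> ?V"
    using G by (auto simp: pair_graph_iff)
  obtain f where f: "\<exists>x\<in>?V. f x \<noteq> 0" "\<And>x. x \<in> ?V \<Longrightarrow> rho G * f x = (\<Sum>y\<in>?E `` {x}. f y)"
    using rho_eigenfunction[OF G] by (auto simp: adj_eigenfunction_def)
  define m where "m = Max ((\<lambda>x. \<bar>f x\<bar>) ` ?V)"
  have "m \<in> (\<lambda>x. \<bar>f x\<bar>) ` ?V"
    unfolding m_def using fin G(2) by (intro Max_in) auto
  then obtain x where x: "x \<in> ?V" "\<bar>f x\<bar> = m" by auto
  have bound: "\<bar>f y\<bar> \<le> m" if "y \<in> ?V" for y
    unfolding m_def using fin that by auto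
  then have "0 < m" using f(1) by fastforce
  have "(rho G)\<^sup>2 * m = \<bar>rho G * (rho G * f x)\<bar>"
    by (simp add: abs_mult power2_eq_square mult.assoc[symmetric] flip: x(2))
  also have "rho G * (rho G * f x) = (\<Sum>y\<in>?E `` {x}. rho G * f y)"
    using f(2)[OF x(1)] by (simp add: sum_distrib_left)
  also have "\<dots> = (\<Sum>y\<in>?E `` {x}. \<Sum>z\<in>?E `` {y}. f z)"
    using f(2) sub by (intro sum.cong) auto
  also have "\<bar>\<dots>\<bar> \<le> (\<Sum>y\<in>?E `` {x}. \<bar>\<Sum>z\<in>?E `` {y}. f z\<bar>)" by (rule sum_abs)
  also have "\<dots> \<le> (\<Sum>y\<in>?E `` {x}. \<Sum>z\<in>?E `` {y}. m)"
    using bound sub by (intro sum_mono order_trans[OF sum_abs]) auto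
  also have "\<dots> = real (\<Sum>y\<in>?E `` {x}. card (?E `` {y})) * m"
    by (simp add: sum_distrib_right)
  also have "\<dots> \<le> real c * m"
    using le[OF x(1)] \<open>0 < m\<close> by (intro mult_right_mono) (auto simp del: of_nat_sum)
  finally show ?thesis using \<open>0 < m\<close> by simp
qed

lemma card_arcs_eq_sum_degrees:
  assumes "pair_graph G"
  shows "card (parcs G) = (\<Sum>x\<in>pverts G. card (parcs G `` {x}))"
proof -
  have fin: "finite (pverts G)" and sub: "parcs G \<subseteq> pverts G \<times> pverts G"
    using assms by (auto simp: pair_graph_iff)
  then have "finite (parcs G)" by (meson finite_SigmaI finite_subset)
  moreover have "parcs G = Sigma (pverts G) (\<lambda>x. parcs G `` {x})"
    using sub by auto
  ultimately show ?thesis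
    using fin card_SigmaI[of "pverts G" "\<lambda>x. parcs G `` {x}"] by (simp add: finite_Image)
qed

text \<open>Symmetry of the arcs turns connectedness into strong connectedness, and a walk to a
  second vertex starts with an arc. This is the minimum degree one behind Hong's bound.\<close>

lemma connected_has_neighbour:
  assumes "pair_graph G" "Digraph_Component.connected (with_proj G)"
    and "2 \<le> card (pverts G)" "x \<in> pverts G"
  shows "parcs G `` {x} \<noteq> {}"
proof -
  interpret pair_graph G by (rule assms)
  have "strongly_connected (with_proj G)"
    using assms(2) pair_sym_arcs symmetric_connected_imp_strongly_connected by blast
  moreover obtain y where y: "y \<in> pverts G" "y \<noteq> x"
    using assms(3) by (metis card_2_iff' card_eq_0_iff card_le_Suc0_iff_eq not_less_eq_eq
        numeral_2_eq_2 zero_le)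
  ultimately have "x \<rightarrow>\<^sup>*\<^bsub>with_proj G\<^esub> y"
    using assms(4) by (auto simp: strongly_connected_def)
  then show ?thesis
    using y(2) by (cases rule: converse_reachable_cases) auto
qed

text \<open>Hong's bound, read off from the row sums of the square of the adjacency matrix.\<close>

lemma rho_squared_le_arcs:
  assumes G: "pair_graph G" "Digraph_Component.connected (with_proj G)"
    and n: "2 \<le> card (pverts G)"
  shows "(rho G)\<^sup>2 \<le> real (card (parcs G)) - real (card (pverts G)) + 1"
proof -
  let ?V = "pverts G" and ?E = "parcs G"
  have fin: "finite ?V" and sub: "?E \<subseteq> ?V \<times> ?V" and irr: "irrefl ?E"
    using G by (auto simp: pair_graph_iff)
  then have finE: "finite ?E" by (meson finite_SigmaI finite_subset)
  have deg: "1 \<le> card (?E `` {y})" if "y \<in> ?V" for y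
    using connected_has_neighbour[OF G n that] finE by (simp add: finite_Image Suc_le_eq card_gt_0_iff)
  \<comment> \<open>In the sum of all degrees, \<open>x\<close> contributes \<open>card ?N\<close>,
    and each of the other \<open>card ?V - 1 - card ?N\<close> vertices outside \<open>?N\<close>
    contributes at least one. Together this is at least \<open>card ?V - 1\<close>.\<close>
  have "(\<Sum>y\<in>?E `` {x}. card (?E `` {y})) + (card ?V - 1) \<le> card ?E" if x: "x \<in> ?V" for x
  proof -
    let ?N = "?E `` {x}"
    have N: "?N \<subseteq> ?V - {x}" using sub irr by (auto simp: irrefl_def)
    have "card ?E = card ?N + (\<Sum>y\<in>?V - {x}. card (?E `` {y}))"
      unfolding card_arcs_eq_sum_degrees[OF G(1)] by (rule sum.remove[OF fin x])
    also have "(\<Sum>y\<in>?V - {x}. card (?E `` {y})) =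
        (\<Sum>y\<in>?V - {x} - ?N. card (?E `` {y})) + (\<Sum>y\<in>?N. card (?E `` {y}))"
      by (rule sum.subset_diff[OF N]) (use fin in simp)
    finally have "card ?E = card ?N + ((\<Sum>y\<in>?V - {x} - ?N. card (?E `` {y})) +
        (\<Sum>y\<in>?N. card (?E `` {y})))" .
    moreover have "card (?V - {x} - ?N) \<le> (\<Sum>y\<in>?V - {x} - ?N. card (?E `` {y}))"
      using sum_mono[of "?V - {x} - ?N" "\<lambda>_. 1" "\<lambda>y. card (?E `` {y})"] deg by auto
    moreover have "card (?V - {x} - ?N) = card ?V - 1 - card ?N"
      using card_Diff_subset[of ?N "?V - {x}"] N fin x by (simp add: finite_subset)
    moreover have "card ?N \<le> card ?V - 1"
      using card_mono[OF _ N] fin x by simp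
    ultimately show ?thesis by linarith
  qed
  then have "(\<Sum>y\<in>?E `` {x}. card (?E `` {y})) \<le> card ?E - (card ?V - 1)" if "x \<in> ?V" for x
    using that by (meson add_le_imp_le_diff)
  then have "(rho G)\<^sup>2 \<le> real (card ?E - (card ?V - 1))"
    using n by (intro rho_squared_le[OF G(1)]) auto
  \<comment> \<open>Ensures that the subtraction of natural numbers above is not truncated.\<close>
  moreover have "card ?V - 1 \<le> card ?E"
  proof -
    have "(\<Sum>y\<in>?V. 1) \<le> (\<Sum>y\<in>?V. card (?E `` {y}))"
      by (rule sum_mono) (use deg in auto)
    then show ?thesis using card_arcs_eq_sum_degrees[OF G(1)] by simp
  qed
  ultimately show ?thesis using n by (simp add: of_nat_diff)
qed


subsection \<open>Barriers and missing arcs\<close>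

text \<open>The empty set has nonnegative value, so the deficiency is nonnegative. Some set attains
  it; if the empty set is not the only barrier, then a nonempty set does.\<close>

lemma not_generalized_bicriticalE:
  assumes "pair_graph G" "even (card (pverts G))" "\<not> generalized_bicritical k G"
  obtains S where "S \<subseteq> pverts G" "S \<noteq> {}" "0 \<le> barrier_value k G S"
proof -
  have fin: "finite (barrier_value k G ` Pow (pverts G))"
    using assms(1) by (auto simp: pair_graph_iff)
  have "0 \<le> barrier_value k G {}"
    by (simp add: barrier_value_def)
  also have "\<dots> \<le> k_deficiency k G"
    unfolding k_deficiency_def using fin by (intro Max_ge) auto
  finally have nonneg: "0 \<le> k_deficiency k G" .
  have "k_deficiency k G \<in> barrier_value k G ` Pow (pverts G)"
    unfolding k_deficiency_def using fin by (intro Max_in) auto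
  then obtain S where S: "k_barrier k G S"
    by (auto simp: k_barrier_def)
  have "\<exists>S. k_barrier k G S \<and> S \<noteq> {}"
    using assms(2,3) S unfolding generalized_bicritical_def by blast
  with nonneg that show thesis
    unfolding k_barrier_def by metis
qed

lemma num_isolated_delete_verts:
  assumes "pair_graph G"
  shows "num_isolated (delete_verts G S) = card {v \<in> pverts G - S. parcs G `` {v} \<subseteq> S}"
proof -
  have sub: "parcs G \<subseteq> pverts G \<times> pverts G" and sym: "sym (parcs G)"
    using assms by (auto simp: pair_graph_iff)
  have "out_arcs (delete_verts G S) v = {} \<longleftrightarrow> parcs G `` {v} \<subseteq> S" if "v \<in> pverts G - S" for v
    using that sub by (auto simp: out_arcs_def delete_verts_def)
  moreover have "in_arcs (delete_verts G S) v = {}"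
    if "v \<in> pverts G - S" "parcs G `` {v} \<subseteq> S" for v
    using that sub symD[OF sym] by (auto simp: in_arcs_def delete_verts_def)
  ultimately show ?thesis
    unfolding num_isolated_def by (intro arg_cong[where f=card]) (auto simp: delete_verts_def)
qed

text \<open>Extracts from the component structure what the edge count uses: disjoint blocks of at
  least three vertices that receive no arcs from the rest of \<open>G - S\<close> and contain none
  of its isolated vertices.\<close>

lemma odd_components_family:
  fixes G :: "'a pair_pre_digraph" and S :: "'a set"
  assumes "pair_graph G"
  obtains Q where "card Q = num_odd_components (delete_verts G S)"
    "\<And>C. C \<in> Q \<Longrightarrow> C \<subseteq> pverts G - S" "\<And>C. C \<in> Q \<Longrightarrow> 3 \<le> card C" "pairwise disjnt Q"
    "\<And>C x y. C \<in> Q \<Longrightarrow> x \<in> C \<Longrightarrow> y \<in> pverts G - S - C \<Longrightarrow> (y, x) \<notin> parcs G"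
    "\<And>C x. C \<in> Q \<Longrightarrow> x \<in> C \<Longrightarrow> \<not> parcs G `` {x} \<subseteq> S"
proof -
  interpret pair_graph G by (rule assms)
  define H where "H = delete_verts G S"
  have vH: "verts H = pverts G - S"
    by (simp add: H_def delete_verts_def)
  have "induced_subgraph H (with_proj G)"
    unfolding H_def delete_verts_def by (rule induced_induce) auto
  then interpret H: sym_digraph H
    by (rule induced_graph_imp_graph)
  have adj: "x \<rightarrow>\<^bsub>H\<^esub> y \<longleftrightarrow> (x, y) \<in> parcs G \<and> x \<notin> S \<and> y \<notin> S" for x y
    using wellformed' by (auto simp: H_def delete_verts_def arcs_ends_conv image_iff)
  define Q where "Q = verts ` {C \<in> H.sccs. odd (card (verts C)) \<and> card (verts C) \<ge> 3}"
  have Q: "C \<in> H.sccs_verts" "3 \<le> card C" if "C \<in> Q" for C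
    using that by (auto simp: Q_def H.sccs_verts_conv)
  show thesis
  proof (rule that[of Q])
    show "card Q = num_odd_components (delete_verts G S)"
      unfolding Q_def num_odd_components_def H_def[symmetric]
      by (rule card_image) (rule inj_on_subset[OF H.inj_on_verts_sccs], auto)
  next
    fix C assume "C \<in> Q"
    then show "C \<subseteq> pverts G - S" "3 \<le> card C"
      using Q H.sccs_verts_subsets vH by blast+
  next
    show "pairwise disjnt Q"
      unfolding pairwise_def disjnt_def using Q H.sccs_verts_disjoint by blast
  next
    fix C x y assume C: "C \<in> Q" "x \<in> C" "y \<in> pverts G - S - C"
    show "(y, x) \<notin> parcs G"
    proof
      assume "(y, x) \<in> parcs G"
      then have "y \<rightarrow>\<^sup>*\<^bsub>H\<^esub> x"
        using C Q(1)[OF C(1)] H.sccs_verts_subsets vH adj by blast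
      then show False
        using C Q(1)[OF C(1)] H.symmetric_reachable' unfolding H.in_sccs_verts_conv_reachable
        by blast
    qed
  next
    fix C x assume C: "C \<in> Q" "x \<in> C"
    \<comment> \<open>A block has a second vertex, reachable from \<open>x\<close> in
      \<open>G - S\<close>; the first arc of that walk ends outside \<open>S\<close>.\<close>
    have "\<not> C \<subseteq> {x}"
      using Q(2)[OF C(1)] card_mono[of "{x}" C] by auto
    then obtain u where "u \<in> C" "u \<noteq> x" by blast
    then have "x \<rightarrow>\<^sup>*\<^bsub>H\<^esub> u" "u \<noteq> x"
      using C Q(1)[OF C(1)] unfolding H.in_sccs_verts_conv_reachable by blast+
    then show "\<not> parcs G `` {x} \<subseteq> S"
      by (cases rule: H.converse_reachable_cases) (auto simp: adj)
  qed
qed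

text \<open>Each vertex of \<open>S\<close> not matched by an isolated vertex must be paid for by
  \<open>k\<close> odd components, so there are at least three. Every vertex outside
  \<open>S\<close> then misses two components, hence six vertices, and at least half of all vertices
  lie outside \<open>S\<close>: at least \<open>3 * card (pverts G)\<close> arcs are
  missing.\<close>

lemma card_arcs_few_isolated:
  assumes G: "pair_graph G" and S: "S \<subseteq> pverts G" and k: "3 \<le> k"
    and barrier: "0 \<le> barrier_value k G S"
    and less: "card {v \<in> pverts G - S. parcs G `` {v} \<subseteq> S} < card S"
  shows "card (parcs G) + 2 * card (pverts G) \<le> card (pverts G) * (card (pverts G) - 1)"
proof -
  let ?V = "pverts G" and ?E = "parcs G"
  have fin: "finite ?V" and sub: "?E \<subseteq> ?V \<times> ?V" and irr: "irrefl ?E"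
    using G by (auto simp: pair_graph_iff)
  define W where "W = ?V - S"
  define I where "I = {v \<in> W. ?E `` {v} \<subseteq> S}"
  show ?thesis
  proof (rule odd_components_family[OF G, of S])
    fix Q assume "card Q = num_odd_components (delete_verts G S)"
      "\<And>C. C \<in> Q \<Longrightarrow> C \<subseteq> ?V - S" "\<And>C. C \<in> Q \<Longrightarrow> 3 \<le> card C" "pairwise disjnt Q"
      "\<And>C x y. C \<in> Q \<Longrightarrow> x \<in> C \<Longrightarrow> y \<in> ?V - S - C \<Longrightarrow> (y, x) \<notin> ?E"
      "\<And>C x. C \<in> Q \<Longrightarrow> x \<in> C \<Longrightarrow> \<not> ?E `` {x} \<subseteq> S"
    note Q = this[folded W_def]
    have "int k * int (card S) \<le> int (card Q) + int k * int (card I)"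
      using barrier unfolding barrier_value_def num_isolated_delete_verts[OF G] Q(1) I_def W_def
      by simp
    then have le: "k * card S \<le> card Q + k * card I"
      by (metis (no_types) of_nat_add of_nat_le_iff of_nat_mult)
    have less': "card I + 1 \<le> card S"
      using less by (simp add: I_def W_def)
    have "k * (card I + 1) \<le> k * card S"
      using less' by (rule mult_le_mono2)
    with le k have q3: "3 \<le> card Q" by simp
    have sle: "card S \<le> card I + card Q"
    proof (rule ccontr)
      assume "\<not> card S \<le> card I + card Q"
      then have "k * (card I + card Q + 1) \<le> k * card S"
        by (intro mult_le_mono2) simp
      with le have "k * card Q + k \<le> card Q" by (simp add: algebra_simps)
      moreover have "1 * card Q \<le> k * card Q" using k by (intro mult_le_mono1) simp
      ultimately show False using k by simp
    qed
    have finW: "finite W" using fin by (simp add: W_def)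
    have finC: "finite C" if "C \<in> Q" for C
      using Q(2)[OF that] finW by (rule finite_subset)
    have "card (\<Union>Q) = (\<Sum>C\<in>Q. card C)"
      using Q(4) finC by (intro card_Union_disjoint) auto
    moreover have "(\<Sum>C\<in>Q. 1) \<le> (\<Sum>C\<in>Q. card C)"
      using Q(3) by (intro sum_mono) (meson le_trans one_le_numeral)
    ultimately have "card Q \<le> card (\<Union>Q)" by simp
    moreover have "card I + card (\<Union>Q) \<le> card W"
    proof -
      have "I \<union> \<Union>Q \<subseteq> W" using Q(2) by (auto simp: I_def)
      moreover have "I \<inter> \<Union>Q = {}" using Q(6) by (auto simp: I_def)
      ultimately show ?thesis
        using card_mono[OF finW, of "I \<union> \<Union>Q"] card_Un_disjoint[of I "\<Union>Q"]
          finite_subset[OF _ finW] by auto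
    qed
    ultimately have sW: "card S \<le> card W" using sle by simp
    have VSW: "card ?V = card S + card W"
      using card_Diff_subset[of S ?V] card_mono[OF fin S] finite_subset[OF S fin] S
      by (simp add: W_def)
    have deg: "card (?E `` {x}) \<le> card ?V - 1" if "x \<in> ?V" for x
      using card_mono[of "?V - {x}" "?E `` {x}"] fin sub irr that by (auto simp: irrefl_def)
    have degW: "card (?E `` {x}) + 6 \<le> card ?V - 1" if x: "x \<in> W" for x
    proof -
      \<comment> \<open>Of three disjoint blocks at most one contains \<open>x\<close>; the other
        two contain no neighbour of \<open>x\<close>.\<close>
      have "\<exists>A\<subseteq>Q. card A = 3" using obtain_subset_with_card_n[OF q3] by metis
      then obtain A B C where ABC: "{A, B, C} \<subseteq> Q" "A \<noteq> B" "A \<noteq> C" "B \<noteq> C"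
        by (auto simp: card_3_iff)
      then have dj: "A \<inter> B = {}" "A \<inter> C = {}" "B \<inter> C = {}"
        using Q(4) by (auto simp: pairwise_def disjnt_def)
      obtain C1 C2 where C: "C1 \<in> Q" "C2 \<in> Q" "x \<notin> C1" "x \<notin> C2" "C1 \<inter> C2 = {}"
        using ABC dj by (metis disjoint_iff insert_subset)
      have "?E `` {x} \<inter> (C1 \<union> C2) = {}"
        using C Q(5) x by auto
      moreover have "card (C1 \<union> C2) = card C1 + card C2"
        using C finC by (intro card_Un_disjoint) auto
      ultimately have "card (?E `` {x} \<union> (C1 \<union> C2)) \<ge> card (?E `` {x}) + 6"
        using C finC Q(3)[OF C(1)] Q(3)[OF C(2)] fin sub
        by (subst card_Un_disjoint) (auto intro: finite_subset)
      moreover have "?E `` {x} \<union> (C1 \<union> C2) \<subseteq> ?V - {x}"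
        using C Q(2) sub irr by (auto simp: irrefl_def W_def)
      then have "card (?E `` {x} \<union> (C1 \<union> C2)) \<le> card (?V - {x})"
        using fin by (intro card_mono) auto
      ultimately show ?thesis using x fin by (simp add: W_def)
    qed
    have "card ?E = (\<Sum>x\<in>W. card (?E `` {x})) + (\<Sum>x\<in>S. card (?E `` {x}))"
      unfolding card_arcs_eq_sum_degrees[OF G] W_def by (rule sum.subset_diff[OF S fin])
    moreover have "(\<Sum>x\<in>S. card (?E `` {x})) \<le> card S * (card ?V - 1)"
      using sum_bounded_above[of S "\<lambda>x. card (?E `` {x})" "card ?V - 1"] deg S by auto
    moreover have "(\<Sum>x\<in>W. card (?E `` {x}) + 6) \<le> card W * (card ?V - 1)"
      using sum_bounded_above[of W "\<lambda>x. card (?E `` {x}) + 6" "card ?V - 1"] degW by auto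
    then have "(\<Sum>x\<in>W. card (?E `` {x})) + 6 * card W \<le> card W * (card ?V - 1)"
      by (simp add: sum.distrib)
    moreover have "card ?V * (card ?V - 1) = card S * (card ?V - 1) + card W * (card ?V - 1)"
      unfolding VSW by (rule distrib_right)
    ultimately show ?thesis using sW VSW by linarith
  qed
qed

text \<open>The arcs of $K_s \vee (K_{n-2s} + sK_1)$, where \<open>S\<close> is the clique that is joined to
  everything and \<open>T\<close> the set of the other $s$ vertices that are isolated outside \<open>S\<close>.\<close>

definition split_arcs :: "'a set \<Rightarrow> 'a set \<Rightarrow> 'a set \<Rightarrow> 'a rel" where
  "split_arcs V S T =
    {(x, y). x \<in> V \<and> y \<in> V \<and> x \<noteq> y \<and> (x \<in> T \<longrightarrow> y \<in> S) \<and> (y \<in> T \<longrightarrow> x \<in> S)}"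

section \<open>Counting arcs of the split graphs\<close>

lemma card_off_diagonal:
  assumes "finite X"
  shows "card (Sigma X (\<lambda>x. X - {x})) = card X * (card X - 1)"
  using assms by simp

text \<open>Counts the complement: the ordered pairs of distinct vertices that are not arcs lie
  inside \<open>T\<close>, or join \<open>T\<close> to the rest \<open>R\<close> in either
  direction.\<close>

lemma card_split_arcs:
  assumes fin: "finite V" and sub: "S \<subseteq> V" "T \<subseteq> V" "S \<inter> T = {}" and card: "card T = card S"
  shows "card (split_arcs V S T) + card S * (card S - 1) + 2 * (card S * (card V - 2 * card S))
    = card V * (card V - 1)"
proof -
  define R where "R = V - (S \<union> T)"
  have finST: "finite S" "finite T" "finite R"
    using fin sub by (auto simp: R_def intro: finite_subset)
  have cR: "card R = card V - 2 * card S"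
    unfolding R_def using sub finST card by (subst card_Diff_subset) (auto simp: card_Un_disjoint)
  let ?D = "Sigma T (\<lambda>x. T - {x})"
  have eq: "Sigma V (\<lambda>x. V - {x}) = split_arcs V S T \<union> (?D \<union> (T \<times> R \<union> R \<times> T))"
    using sub by (auto simp: split_arcs_def R_def)
  have finM: "finite (split_arcs V S T)"
    by (rule finite_subset[of _ "V \<times> V"]) (use fin in \<open>auto simp: split_arcs_def\<close>)
  have "card (split_arcs V S T \<union> (?D \<union> (T \<times> R \<union> R \<times> T))) =
      card (split_arcs V S T) + (card ?D + (card (T \<times> R) + card (R \<times> T)))"
    using finM finST sub
    by (subst card_Un_disjoint; (subst card_Un_disjoint)?; (subst card_Un_disjoint)?)
       (auto simp: split_arcs_def R_def)
  then show ?thesis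
    unfolding eq[symmetric] card_off_diagonal[OF fin] card_off_diagonal[OF finST(2)]
    by (simp add: card_cartesian_product card cR)
qed

text \<open>Allowing any subset \<open>T\<close> of the isolated vertices permits choosing one of
  exactly \<open>card S\<close> elements.\<close>

lemma subset_split_arcs:
  assumes "pair_graph G" "T \<subseteq> {v \<in> pverts G - S. parcs G `` {v} \<subseteq> S}"
  shows "parcs G \<subseteq> split_arcs (pverts G) S T"
proof (rule subrelI)
  fix x y assume xy: "(x, y) \<in> parcs G"
  have "parcs G \<subseteq> pverts G \<times> pverts G" "irrefl (parcs G)" "(y, x) \<in> parcs G"
    using assms(1) xy by (auto simp: pair_graph_iff dest: symD)
  then show "(x, y) \<in> split_arcs (pverts G) S T"
    using xy assms(2) by (auto simp: split_arcs_def irrefl_def)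
qed

text \<open>A missing edge costs both of its orientations.\<close>

lemma sym_subset_split_arcs:
  assumes "finite V" "sym E" "E \<subseteq> split_arcs V S T" "E \<noteq> split_arcs V S T"
  shows "card E + 2 \<le> card (split_arcs V S T)"
proof -
  obtain x y where xy: "(x, y) \<in> split_arcs V S T" "(x, y) \<notin> E"
    using assms by auto
  then have yx: "(y, x) \<in> split_arcs V S T" "(y, x) \<notin> E" "x \<noteq> y"
    using assms(2) by (auto simp: split_arcs_def dest: symD)
  have fin: "finite (split_arcs V S T)"
    by (rule finite_subset[of _ "V \<times> V"]) (use assms(1) in \<open>auto simp: split_arcs_def\<close>)
  have "card (E \<union> {(x, y), (y, x)}) = card E + 2"
    using xy yx finite_subset[OF assms(3) fin] by (subst card_Un_disjoint) auto
  moreover have "card (E \<union> {(x, y), (y, x)}) \<le> card (split_arcs V S T)"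
    using xy yx assms(3) by (intro card_mono[OF fin]) auto
  ultimately show ?thesis by simp
qed

text \<open>Arcs are pairs of vertices, so the arc map of the isomorphism has to be
  \<open>map_prod f f\<close>; a vertex bijection respecting adjacency is enough.\<close>

lemma digraph_iso_with_projI:
  assumes "pair_graph G" "bij_betw f (pverts G) (pverts H)"
    and "parcs H \<subseteq> pverts H \<times> pverts H"
    and "\<And>x y. x \<in> pverts G \<Longrightarrow> y \<in> pverts G \<Longrightarrow> (x, y) \<in> parcs G \<longleftrightarrow> (f x, f y) \<in> parcs H"
  shows "digraph_iso (with_proj G) (with_proj H)"
proof -
  interpret pair_graph G by (rule assms)
  have sub: "parcs G \<subseteq> pverts G \<times> pverts G"
    using assms(1) by (auto simp: pair_graph_iff)
  have inj: "inj_on f (pverts G)" and im: "f ` pverts G = pverts H"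
    using assms(2) by (auto simp: bij_betw_def)
  have arcs: "map_prod f f ` parcs G = parcs H"
  proof
    show "map_prod f f ` parcs G \<subseteq> parcs H"
      using sub assms(4) by auto
    show "parcs H \<subseteq> map_prod f f ` parcs G"
    proof (rule subrelI)
      fix a b assume ab: "(a, b) \<in> parcs H"
      then have "a \<in> f ` pverts G" "b \<in> f ` pverts G"
        using assms(3) unfolding im by auto
      then obtain x y where xy: "x \<in> pverts G" "y \<in> pverts G" "a = f x" "b = f y" by blast
      then have "(x, y) \<in> parcs G"
        using ab assms(4) by simp
      then show "(a, b) \<in> map_prod f f ` parcs G"
        unfolding xy by (rule map_prod_imageI)
    qed
  qed
  let ?h = "\<lparr>iso_verts = f, iso_arcs = map_prod f f, iso_head = snd, iso_tail = fst\<rparr>"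
  have "inj_on (map_prod f f) (parcs G)"
    using map_prod_inj_on[OF inj inj] sub by (rule inj_on_subset)
  then have "digraph_isomorphism ?h"
    unfolding digraph_isomorphism_def using inj wf_digraph_axioms by auto
  moreover have "with_proj H = app_iso ?h (with_proj G)"
    by (simp add: app_iso_def with_proj_def im arcs)
  ultimately show ?thesis
    unfolding digraph_iso_def by blast
qed

subsection \<open>The extremal graphs\<close>

lemma graph_join_arcs:
  "(Inl a, Inl a') \<in> parcs (graph_join G H) \<longleftrightarrow> (a, a') \<in> parcs G"
  "(Inr b, Inr b') \<in> parcs (graph_join G H) \<longleftrightarrow> (b, b') \<in> parcs H"
  "(Inl a, Inr b) \<in> parcs (graph_join G H) \<longleftrightarrow> a \<in> pverts G \<and> b \<in> pverts H"
  "(Inr b, Inl a) \<in> parcs (graph_join G H) \<longleftrightarrow> a \<in> pverts G \<and> b \<in> pverts H"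
  by (auto simp: graph_join_def)

lemma disjoint_union_arcs:
  "(Inl a, Inl a') \<in> parcs (disjoint_union G H) \<longleftrightarrow> (a, a') \<in> parcs G"
  "(Inr b, Inr b') \<in> parcs (disjoint_union G H) \<longleftrightarrow> (b, b') \<in> parcs H"
  "(Inl a, Inr b) \<notin> parcs (disjoint_union G H)"
  "(Inr b, Inl a) \<notin> parcs (disjoint_union G H)"
  by (auto simp: disjoint_union_def)

lemma complete_graph_arcs: "(i, j) \<in> parcs (complete_graph m) \<longleftrightarrow> i < m \<and> j < m \<and> i \<noteq> j"
  by (simp add: complete_graph_def)

lemma edgeless_graph_arcs: "(i, j) \<notin> parcs (edgeless_graph m)"
  by (simp add: edgeless_graph_def)

lemma construction_verts:
  "pverts (complete_graph m) = {0..<m}"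
  "pverts (edgeless_graph m) = {0..<m}"
  "pverts (disjoint_union G H) = Inl ` pverts G \<union> Inr ` pverts H"
  "pverts (graph_join G H) = Inl ` pverts G \<union> Inr ` pverts H"
  by (simp_all add: complete_graph_def edgeless_graph_def disjoint_union_def graph_join_def)

lemmas construction_simps = graph_join_arcs disjoint_union_arcs complete_graph_arcs
  edgeless_graph_arcs construction_verts

lemma set_sum_eqI:
  assumes "\<And>a. Inl a \<in> A \<longleftrightarrow> Inl a \<in> B" "\<And>b. Inr b \<in> A \<longleftrightarrow> Inr b \<in> B"
  shows "A = B"
proof (rule Set.set_eqI)
  fix x show "x \<in> A \<longleftrightarrow> x \<in> B" by (cases x) (simp_all add: assms)
qed

lemma construction_neighbours:
  "parcs (complete_graph m) `` {i} = (if i < m then {0..<m} - {i} else {})"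
  "parcs (edgeless_graph m) `` {i} = {}"
  "parcs (disjoint_union G H) `` {Inl a} = Inl ` (parcs G `` {a})"
  "parcs (disjoint_union G H) `` {Inr b} = Inr ` (parcs H `` {b})"
  "parcs (graph_join G H) `` {Inl a} =
    Inl ` (parcs G `` {a}) \<union> (if a \<in> pverts G then Inr ` pverts H else {})"
  "parcs (graph_join G H) `` {Inr b} =
    Inr ` (parcs H `` {b}) \<union> (if b \<in> pverts H then Inl ` pverts G else {})"
  by (auto simp: construction_simps intro!: set_sum_eqI)

lemma bij_betw_inj_image:
  assumes "bij_betw g A B" "inj i" "\<And>x. x \<in> A \<Longrightarrow> f x = i (g x)"
  shows "bij_betw f A (i ` B)"
proof -
  have "bij_betw i B (i ` B)"
    using assms(2) inj_on_subset[of i UNIV B] by (simp add: inj_on_imp_bij_betw)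
  with assms(1) have "bij_betw (i \<circ> g) A (i ` B)"
    by (rule bij_betw_trans)
  then show ?thesis
    by (rule bij_betw_cong[THEN iffD1, rotated]) (simp add: assms(3))
qed

section \<open>Recognising the extremal graphs\<close>

text \<open>With no vertices outside \<open>S \<union> T\<close>, adjacency of distinct vertices
  depends only on their sides, so arbitrary bijections of \<open>S\<close> and \<open>T\<close> onto
  the two operands work.\<close>

lemma digraph_iso_join_edgeless:
  assumes G: "pair_graph G" and ST: "S \<inter> T = {}" "pverts G = S \<union> T" "card S = s" "card T = s"
    and E: "parcs G = split_arcs (pverts G) S T"
  shows "digraph_iso (with_proj G) (with_proj (graph_join (complete_graph s) (edgeless_graph s)))"
proof -
  have fin: "finite S" "finite T"
    using G ST by (auto simp: pair_graph_iff)
  obtain g h where g: "bij_betw g S {0..<s}" and h: "bij_betw h T {0..<s}"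
    using ex_bij_betw_finite_nat fin ST(3,4) by metis
  define f where "f x = (if x \<in> S then Inl (g x) else Inr (h x))" for x
  show ?thesis
  proof (rule digraph_iso_with_projI[where f=f, OF G])
    have "bij_betw f S (Inl ` {0..<s})"
      by (rule bij_betw_inj_image[OF g]) (auto simp: f_def)
    moreover have "bij_betw f T (Inr ` {0..<s})"
      by (rule bij_betw_inj_image[OF h]) (use ST(1) in \<open>auto simp: f_def\<close>)
    ultimately have "bij_betw f (S \<union> T) (Inl ` {0..<s} \<union> Inr ` {0..<s})"
      by (rule bij_betw_combine) auto
    then show "bij_betw f (pverts G) (pverts (graph_join (complete_graph s) (edgeless_graph s)))"
      by (simp add: ST(2) construction_verts)
  next
    show "parcs (graph_join (complete_graph s) (edgeless_graph s)) \<subseteq>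
        pverts (graph_join (complete_graph s) (edgeless_graph s)) \<times>
        pverts (graph_join (complete_graph s) (edgeless_graph s))"
      using pair_graph_constructions by (metis pair_graph_iff)
  next
    fix x y assume xy: "x \<in> pverts G" "y \<in> pverts G"
    have "g a \<in> {0..<s}" "g a = g b \<longleftrightarrow> a = b" if "a \<in> S" "b \<in> S" for a b
      using g that by (auto simp: bij_betw_def inj_on_def)
    moreover have "h a \<in> {0..<s}" if "a \<in> T" for a
      using h that by (auto simp: bij_betw_def)
    ultimately show "(x, y) \<in> parcs G \<longleftrightarrow>
        (f x, f y) \<in> parcs (graph_join (complete_graph s) (edgeless_graph s))"
      using xy ST(1,2) unfolding E
      by (auto simp: f_def split_arcs_def construction_simps)
  qed
qed

lemma digraph_iso_pendant:
  assumes G: "pair_graph G" and uv: "u \<in> pverts G" "v \<in> pverts G" "u \<noteq> v"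
    and E: "parcs G = split_arcs (pverts G) {u} {v}"
  shows "digraph_iso (with_proj G) (with_proj (graph_join (complete_graph 1)
    (disjoint_union (complete_graph (card (pverts G) - 2)) (complete_graph 1))))"
    (is "digraph_iso _ (with_proj ?H)")
proof -
  define m where "m = card (pverts G) - 2"
  have fin: "finite (pverts G)"
    using G by (auto simp: pair_graph_iff)
  have "card (pverts G - {u, v}) = m"
    using fin uv by (simp add: card_Diff_subset m_def)
  then obtain g where g: "bij_betw g (pverts G - {u, v}) {0..<m}"
    using ex_bij_betw_finite_nat[of "pverts G - {u, v}"] fin by auto
  \<comment> \<open>\<open>u\<close> becomes the dominating vertex, \<open>v\<close> the pendant
    one, and all others form the large clique.\<close>
  define f where "f x = (if x = u then Inl (0::nat) else if x = v then Inr (Inr (0::nat))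
    else Inr (Inl (g x)))" for x
  show ?thesis
    unfolding m_def[symmetric]
  proof (rule digraph_iso_with_projI[where f=f, OF G])
    let ?H = "graph_join (complete_graph 1) (disjoint_union (complete_graph m) (complete_graph 1))"
    have "bij_betw f (pverts G - {u, v}) ((Inr \<circ> Inl) ` {0..<m})"
      by (rule bij_betw_inj_image[OF g]) (auto simp: f_def inj_def)
    moreover have "bij_betw f {u, v} {Inl 0, Inr (Inr 0)}"
      using uv by (auto simp: bij_betw_def f_def)
    ultimately have "bij_betw f ((pverts G - {u, v}) \<union> {u, v})
        ((Inr \<circ> Inl) ` {0..<m} \<union> {Inl 0, Inr (Inr 0)})"
      by (rule bij_betw_combine) auto
    moreover have "(pverts G - {u, v}) \<union> {u, v} = pverts G" using uv by auto
    moreover have "(Inr \<circ> Inl) ` {0..<m} \<union> {Inl 0, Inr (Inr 0)} = pverts ?H"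
      by (intro set_sum_eqI) (auto simp: construction_simps)
    ultimately show "bij_betw f (pverts G) (pverts ?H)" by simp
    show "parcs ?H \<subseteq> pverts ?H \<times> pverts ?H"
      using pair_graph_constructions by (metis pair_graph_iff)
    fix x y assume xy: "x \<in> pverts G" "y \<in> pverts G"
    have "x \<noteq> u \<Longrightarrow> x \<noteq> v \<Longrightarrow> g x < m" "y \<noteq> u \<Longrightarrow> y \<noteq> v \<Longrightarrow> g y < m"
      using g xy by (auto simp: bij_betw_def)
    moreover have "g x = g y \<longleftrightarrow> x = y" if "x \<noteq> u" "x \<noteq> v" "y \<noteq> u" "y \<noteq> v"
      using g xy that by (auto simp: bij_betw_def inj_on_def)
    ultimately show "(x, y) \<in> parcs G \<longleftrightarrow> (f x, f y) \<in> parcs ?H"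
      using xy uv unfolding E
      by (cases "x = u"; cases "x = v"; cases "y = u"; cases "y = v")
         (simp_all add: f_def split_arcs_def construction_simps)
  qed
qed

section \<open>Lower bounds for the extremal spectral radii\<close>

text \<open>The quadratic is the characteristic equation of the quotient by the two sides; its
  eigenvector has value \<open>l\<close> on the clique and \<open>s\<close> on the independent
  set.\<close>

lemma rho_join_edgeless_ge:
  assumes s: "1 \<le> s" and l: "0 < l" "l\<^sup>2 = (real s - 1) * l + (real s)\<^sup>2"
  shows "l \<le> rho (graph_join (complete_graph s) (edgeless_graph s))" (is "_ \<le> rho ?H")
proof (rule eigenvalue_le_rho)
  show "pair_graph ?H"
    by (intro pair_graph_constructions)
  define f :: "nat + nat \<Rightarrow> real" where "f = case_sum (\<lambda>_. l) (\<lambda>_. real s)"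
  have nl: "parcs ?H `` {Inl i} = Inl ` ({0..<s} - {i}) \<union> Inr ` {0..<s}" if "i < s" for i
    using that by (simp add: construction_neighbours construction_verts)
  have nr: "parcs ?H `` {Inr i} = Inl ` {0..<s}" if "i < s" for i
    using that by (simp add: construction_neighbours construction_verts)
  have "l * f (Inl i) = (\<Sum>y\<in>parcs ?H `` {Inl i}. f y)" if "i < s" for i
    unfolding nl[OF that] using l(2) that s
    by (subst sum.union_disjoint)
       (auto simp: f_def sum.reindex power2_eq_square of_nat_diff)
  moreover have "l * f (Inr i) = (\<Sum>y\<in>parcs ?H `` {Inr i}. f y)" if "i < s" for i
    unfolding nr[OF that] by (simp add: f_def sum.reindex)
  moreover have "pverts ?H = Inl ` {0..<s} \<union> Inr ` {0..<s}"
    by (simp add: construction_verts)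
  ultimately show "adj_eigenfunction ?H l f"
    using s l(1) by (auto simp: adj_eigenfunction_def f_def intro!: bexI[of _ "Inl 0"])
qed

text \<open>The cubic below is the characteristic polynomial of the quotient matrix; it takes the
  value $-1$ at $n - 2$.\<close>

lemma rho_pendant_gt:
  assumes n: "4 \<le> n"
  shows "real n - 2 < rho (graph_join (complete_graph 1)
    (disjoint_union (complete_graph (n - 2)) (complete_graph 1)))" (is "_ < rho ?H")
proof -
  define p where "p x = x\<^sup>2 * (x - real n + 3) - (real n - 2) * x - (x - real n + 3)" for x :: real
  have lo: "p (real n - 2) = -1" by (simp add: p_def power2_eq_square)
  have "p (real n) = 2 * (real n)\<^sup>2 + 2 * real n - 3"
    by (simp add: p_def power2_eq_square algebra_simps)
  then have hi: "0 \<le> p (real n)"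
    using n zero_le_power2[of "real n"] by linarith
  have "continuous_on {real n - 2..real n} p"
    unfolding p_def by (intro continuous_intros)
  then have "\<exists>l\<ge>real n - 2. l \<le> real n \<and> p l = 0"
    by (intro IVT') (simp_all add: lo hi)
  then obtain l where l: "real n - 2 \<le> l" "p l = 0" by blast
  have gt: "real n - 2 < l" using l lo by (cases "l = real n - 2") auto
  then have pos: "0 < l" using n by simp
  \<comment> \<open>With value 1 on the large clique, the equation there forces value
    \<open>a\<close> at the dominating vertex and hence \<open>a / l\<close> at the pendant one. The
    equation at the dominating vertex is then \<open>p l = 0\<close>.\<close>
  define a where "a = l - real n + 3"
  have root: "l * a = real n - 2 + a / l"
    using l(2) pos by (simp add: p_def a_def field_simps power2_eq_square)
  define f :: "nat + nat + nat \<Rightarrow> real"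
    where "f = case_sum (\<lambda>_. a) (case_sum (\<lambda>_. 1) (\<lambda>_. a / l))"
  have vH: "pverts ?H = {Inl 0, Inr (Inr 0)} \<union> (Inr \<circ> Inl) ` {0..<n - 2}"
    by (intro set_sum_eqI) (auto simp: construction_simps)
  have nu: "parcs ?H `` {Inl 0} = insert (Inr (Inr 0)) ((\<lambda>i. Inr (Inl i)) ` {0..<n - 2})"
    by (simp add: construction_neighbours construction_verts image_Un image_image)
  have nv: "parcs ?H `` {Inr (Inr 0)} = {Inl 0}"
    by (simp add: construction_neighbours construction_verts)
  have nw: "parcs ?H `` {Inr (Inl i)} = insert (Inl 0) ((\<lambda>i. Inr (Inl i)) ` ({0..<n - 2} - {i}))"
    if "i < n - 2" for i
    using that by (simp add: construction_neighbours construction_verts image_image)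
  have injI: "inj_on (\<lambda>i. Inr (Inl i)) A" for A by (auto simp: inj_on_def)
  have "l * f (Inl 0) = (\<Sum>y\<in>parcs ?H `` {Inl 0}. f y)"
    unfolding nu using root n
    by (subst sum.insert) (auto simp: sum.reindex[OF injI] f_def o_def of_nat_diff)
  moreover have "l * f (Inr (Inr 0)) = (\<Sum>y\<in>parcs ?H `` {Inr (Inr 0)}. f y)"
    unfolding nv using pos by (simp add: f_def)
  moreover have "l * f (Inr (Inl i)) = (\<Sum>y\<in>parcs ?H `` {Inr (Inl i)}. f y)" if "i < n - 2" for i
    unfolding nw[OF that] using that n
    by (subst sum.insert) (auto simp: sum.reindex[OF injI] f_def o_def of_nat_diff a_def)
  moreover have "f (Inl 0) \<noteq> 0" using gt by (simp add: f_def a_def)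
  ultimately have "adj_eigenfunction ?H l f"
    unfolding adj_eigenfunction_def vH by auto
  moreover have "pair_graph ?H" by (intro pair_graph_constructions)
  ultimately show ?thesis
    using eigenvalue_le_rho gt by (meson less_le_trans)
qed

text \<open>For $n = 8$, $s = 4$ Hong's bound is too weak. The weights approximate the Perron vector
  of $K_4 \vee 4K_1$.\<close>

lemma rho_split_4_4:
  assumes G: "pair_graph G" and ST: "S \<inter> T = {}" "pverts G = S \<union> T" "card S = 4" "card T = 4"
    and E: "parcs G \<subseteq> split_arcs (pverts G) S T"
  shows "rho G < 6"
proof -
  have fin: "finite S" "finite T"
    using G ST by (auto simp: pair_graph_iff)
  define w :: "'a \<Rightarrow> real" where "w x = (if x \<in> S then 10 else 7)" for x
  have wS: "(\<Sum>y\<in>S. w y) = 40" using ST(3) by (simp add: w_def)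
  have "(\<Sum>y\<in>T. w y) = (\<Sum>y\<in>T. 7)"
    using ST(1) by (intro sum.cong) (auto simp: w_def)
  then have wT: "(\<Sum>y\<in>T. w y) = 28" using ST(4) by simp
  have "rho G \<le> 59 / 10"
  proof (rule rho_le_weighted[OF G])
    show "pverts G \<noteq> {}" using ST by auto
    fix x assume x: "x \<in> pverts G"
    show "0 < w x" by (simp add: w_def)
    show "(\<Sum>y\<in>parcs G `` {x}. w y) \<le> 59 / 10 * w x"
    proof (cases "x \<in> S")
      case True
      have "(\<Sum>y\<in>parcs G `` {x}. w y) \<le> (\<Sum>y\<in>(S - {x}) \<union> T. w y)"
        using E ST fin by (intro sum_mono2) (auto simp: split_arcs_def w_def)
      also have "\<dots> = 58"
        using True fin ST(1) wS wT by (subst sum.union_disjoint) (auto simp: sum_diff1 w_def)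
      finally show ?thesis using True by (simp add: w_def)
    next
      case False
      have "(\<Sum>y\<in>parcs G `` {x}. w y) \<le> (\<Sum>y\<in>S. w y)"
        using E ST fin x False by (intro sum_mono2) (auto simp: split_arcs_def w_def)
      then show ?thesis using False unfolding wS by (simp add: w_def)
    qed
  qed
  then show ?thesis by simp
qed


section \<open>Comparison with the extremal graphs, by the number of isolated vertices\<close>

theorem theorem4p2:
  fixes n k :: nat and G :: "'a pair_pre_digraph"
  assumes "n \<ge> 4" and "even n"
    and "k \<ge> 3" and "odd k"
    and "pair_graph G"
    and "Digraph_Component.connected (with_proj G)"
    and "card (pverts G) = n"
  shows
    "(n \<ge> 8 \<and>
       rho G \<ge> rho (graph_join (complete_graph 1)
                      (disjoint_union (complete_graph (n - 2)) (complete_graph 1))) \<longrightarrow>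
       generalized_bicritical k G \<or>
       digraph_iso (with_proj G)
         (with_proj (graph_join (complete_graph 1)
                      (disjoint_union (complete_graph (n - 2)) (complete_graph 1))))) \<and>
     (4 \<le> n \<and> n \<le> 6 \<and>
       rho G \<ge> rho (graph_join (complete_graph (n div 2)) (edgeless_graph (n div 2))) \<longrightarrow>
       generalized_bicritical k G \<or>
       digraph_iso (with_proj G)
         (with_proj (graph_join (complete_graph (n div 2)) (edgeless_graph (n div 2)))))"
proof (cases "generalized_bicritical k G")
  case False
  let ?H1 = "graph_join (complete_graph 1) (disjoint_union (complete_graph (n - 2)) (complete_graph 1))"
  let ?H2 = "graph_join (complete_graph (n div 2)) (edgeless_graph (n div 2))"
  let ?m = "card (parcs G)"
  note n = \<open>card (pverts G) = n\<close> and G = \<open>pair_graph G\<close>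
  have fin: "finite (pverts G)" and sym: "sym (parcs G)"
    using G by (auto simp: pair_graph_iff)
  have hong: "(rho G)\<^sup>2 \<le> real ?m - real n + 1"
    using rho_squared_le_arcs[OF G assms(6)] n assms(1) by simp
  \<comment> \<open>With at least \<open>n - 1\<close> edges missing, Hong's bound is
    \<open>(n - 1) * (n - 3)\<close>, one less than the square of \<open>n - 2\<close>.\<close>
  have small1: "rho G < rho ?H1" if "8 \<le> n" "?m + 2 * (n - 1) \<le> n * (n - 1)"
  proof -
    have "real (?m + 2 * (n - 1)) \<le> real (n * (n - 1))"
      using that(2) by (simp only: of_nat_le_iff)
    then have "real ?m + 2 * (real n - 1) \<le> real n * (real n - 1)"
      using that(1) by (simp add: of_nat_diff)
    then have "(rho G)\<^sup>2 \<le> (real n - 2)\<^sup>2"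
      using hong by (simp add: power2_eq_square algebra_simps)
    then have "rho G \<le> real n - 2"
      by (rule power2_le_imp_le) (use that(1) in simp)
    then show ?thesis
      using rho_pendant_gt[OF \<open>4 \<le> n\<close>] by simp
  qed
  \<comment> \<open>The thresholds are one edge below the 10 and 24 arcs of the extremal graphs.
    Hong's bound gives 5 and 17; the radii are compared with the positive roots of
    \<open>l\<^sup>2 = l + 4\<close> and \<open>l\<^sup>2 = 2 * l + 9\<close>.\<close>
  have small2: "rho G < rho ?H2"
    if "n = 4 \<and> ?m \<le> 8 \<or> n = 6 \<and> ?m \<le> 22"
    using that
  proof
    assume a: "n = 4 \<and> ?m \<le> 8"
    have sq: "((1 + sqrt 17) / 2)\<^sup>2 = (9 + sqrt 17) / 2"
      by (simp add: power_divide power2_sum)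
    have "(rho G)\<^sup>2 \<le> 5" using hong a by simp
    also have "5 < ((1 + sqrt 17) / 2)\<^sup>2"
      unfolding sq using real_less_rsqrt[of 1 17] by simp
    finally have "rho G < (1 + sqrt 17) / 2"
      by (rule power_less_imp_less_base) simp
    also have "(1 + sqrt 17) / 2 \<le> rho (graph_join (complete_graph 2) (edgeless_graph 2))"
      by (rule rho_join_edgeless_ge) (simp_all add: sq add_pos_nonneg)
    finally show ?thesis using a by simp
  next
    assume a: "n = 6 \<and> ?m \<le> 22"
    have sq: "(1 + sqrt 10)\<^sup>2 = 11 + 2 * sqrt 10"
      by (simp add: power2_sum)
    have "(rho G)\<^sup>2 \<le> 17" using hong a by simp
    also have "17 < (1 + sqrt 10)\<^sup>2"
      unfolding sq using real_less_rsqrt[of 3 10] by simp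
    finally have "rho G < 1 + sqrt 10"
      by (rule power_less_imp_less_base) simp
    also have "1 + sqrt 10 \<le> rho (graph_join (complete_graph 3) (edgeless_graph 3))"
      by (rule rho_join_edgeless_ge) (simp_all add: sq add_pos_nonneg)
    finally show ?thesis using a by simp
  qed
  obtain S where S: "S \<subseteq> pverts G" "S \<noteq> {}" "0 \<le> barrier_value k G S"
    using not_generalized_bicriticalE[OF G _ False] n assms(2) by auto
  define I where "I = {v \<in> pverts G - S. parcs G `` {v} \<subseteq> S}"
  define s where "s = card S"
  have s1: "1 \<le> s"
    using S fin by (simp add: s_def Suc_le_eq card_gt_0_iff finite_subset)
  have n_cases: "n = 4 \<or> n = 6" if "4 \<le> n" "n \<le> 6"
    using that assms(2) by presburger
  show ?thesis
  proof (cases "card I < s")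
    case True
    then have le: "?m + 2 * n \<le> n * (n - 1)"
      using card_arcs_few_isolated[OF G S(1) assms(3) S(3)] n by (simp add: I_def s_def)
    have "rho G < rho ?H1" if "8 \<le> n"
      using small1 that le by simp
    moreover have "rho G < rho ?H2" if "4 \<le> n" "n \<le> 6"
      using small2 n_cases[OF that] le by auto
    ultimately show ?thesis by (meson not_le)
  next
    case False
    then obtain T where T: "T \<subseteq> I" "card T = s"
      using obtain_subset_with_card_n[of s I] by (metis not_less)
    have TV: "T \<subseteq> pverts G" "S \<inter> T = {}"
      using T(1) by (auto simp: I_def)
    let ?M = "split_arcs (pverts G) S T"
    have EM: "parcs G \<subseteq> ?M"
      using subset_split_arcs[OF G] T(1) by (simp add: I_def)
    have finS: "finite S" "finite T"
      using fin S(1) TV(1) by (auto intro: finite_subset)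
    have cST: "card (S \<union> T) = 2 * s"
      using finS TV(2) T(2) by (simp add: card_Un_disjoint s_def)
    have STV: "S \<union> T \<subseteq> pverts G"
      using S(1) TV(1) by simp
    have sn: "2 * s \<le> n"
      using card_mono[OF fin STV] cST n by simp
    have cM: "card ?M + s * (s - 1) + 2 * (s * (n - 2 * s)) = n * (n - 1)"
      using card_split_arcs[OF fin S(1) TV] T(2) n by (simp add: s_def)
    have finM: "finite ?M"
      by (rule finite_subset[of _ "pverts G \<times> pverts G"]) (use fin in \<open>auto simp: split_arcs_def\<close>)
    have mM: "?m \<le> card ?M"
      by (rule card_mono[OF finM EM])
    have dich: "parcs G = ?M \<or> ?m + 2 \<le> card ?M"
      using sym_subset_split_arcs[OF fin sym EM] by blast
    have "digraph_iso (with_proj G) (with_proj ?H1) \<or> rho G < rho ?H1" if n8: "8 \<le> n"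
    proof (cases "s = 1")
      case True
      obtain u v where uv: "S = {u}" "T = {v}"
        using True T(2) by (auto simp: s_def card_1_singleton_iff)
      from dich show ?thesis
      proof
        assume "parcs G = ?M"
        then show ?thesis
          using digraph_iso_pendant[OF G, of u v] uv S(1) TV n by auto
      next
        \<comment> \<open>For \<open>s = 1\<close> the split graph lacks \<open>2 * (n - 2)\<close>
          arcs; one further missing edge reaches the threshold of \<open>small1\<close>.\<close>
        assume "?m + 2 \<le> card ?M"
        then have "?m + 2 * (n - 1) \<le> n * (n - 1)"
          using cM True n8 by simp
        then show ?thesis using small1[OF n8] by blast
      qed
    next
      case s_ne_1: False
      show ?thesis
      proof (cases "n = 8 \<and> s = 4")
        case True
        then have "S \<union> T = pverts G"
          using card_subset_eq[OF fin STV] cST n by simp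
        then have "rho G < 6"
          using rho_split_4_4[OF G TV(2) _ _ _ EM] True T(2) by (simp add: s_def)
        then show ?thesis
          using rho_pendant_gt[of n] True by simp
      next
        case False
        \<comment> \<open>Substituting \<open>s = r + 2\<close> and \<open>n = 2 * (s + t)\<close>
          removes the natural subtractions. For \<open>t = 0\<close> the inequality reads
          \<open>4 * s \<le> s * (s - 1) + 2\<close>, which needs \<open>s \<ge> 5\<close>; this is
          why \<open>n = 8\<close>, \<open>s = 4\<close> is treated apart.\<close>
        obtain j where j: "n = 2 * j" using assms(2) by blast
        obtain t where t: "j = s + t" using sn j le_Suc_ex by auto
        obtain r where r: "s = r + 2" using s_ne_1 s1 le_Suc_ex[of 2 s] by fastforce
        have "2 * (n - 1) \<le> s * (s - 1) + 2 * (s * (n - 2 * s))"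
        proof (cases t)
          case 0
          then obtain q where "r = q + 3"
            using False n8 j t r le_Suc_ex[of 3 r] by fastforce
          then show ?thesis using 0 j t r by (simp add: algebra_simps)
        next
          case (Suc q)
          then show ?thesis using j t r by (simp add: algebra_simps)
        qed
        then have "?m + 2 * (n - 1) \<le> n * (n - 1)"
          using cM mM by linarith
        then show ?thesis using small1[OF n8] by blast
      qed
    qed
    moreover have "digraph_iso (with_proj G) (with_proj ?H2) \<or> rho G < rho ?H2"
      if n46: "4 \<le> n" "n \<le> 6"
    proof (cases "2 * s = n \<and> parcs G = ?M")
      case True
      then have "S \<union> T = pverts G"
        using card_subset_eq[OF fin STV] cST n by simp
      then show ?thesis
        using digraph_iso_join_edgeless[OF G TV(2), of "n div 2"] True T(2)
        by (auto simp: s_def)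
    next
      case False
      \<comment> \<open>The split graphs have 8 and 10 arcs for \<open>n = 4\<close>, and 22, 20 and
        24 for \<open>n = 6\<close>. Only the last of each list exceeds the threshold, and there
        \<open>dich\<close> removes two arcs.\<close>
      have "s = 1 \<or> s = 2 \<or> s = 3" using s1 sn n46 by linarith
      then have "n = 4 \<and> ?m \<le> 8 \<or> n = 6 \<and> ?m \<le> 22"
        using n_cases[OF n46] False dich mM cM sn by auto
      then show ?thesis using small2 by blast
    qed
    ultimately show ?thesis by (meson not_le)
  qed
qed simp

end
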